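(* For any integer $h\geq 1$, every graph $G$ with no path on $2h+1$ vertices is contained in $H\boxtimes K_{4h}$ for some graph $H$ with $\mathrm{pw}(H)\leq h-1$.
   Context: All graphs are simple, finite and undirected. "No path on $2h+1$ vertices" means that $G$ has no (not necessarily induced) subgraph isomorphic to the path on $2h+1$ vertices. "$G$ is contained in $G'$" means that $G$ is isomorphic to a subgraph of $G'$. The strong product $A\boxtimes B$ has vertex set $V(A)\times V(B)$, where distinct vertices $(v,x),(w,y)$ are adjacent if ($v=w$ and $xy\in E(B)$), or ($x=y$ and $vw\in E(A)$), or ($vw\in E(A)$ and $xy\in E(B)$). A path-decomposition of a graph $G$ is a sequence $(B_1,\dots,B_n)$ of subsets of $V(G)$ (bags) such that every edge of $G$ has both ends in some bag, and for every vertex $v$ the set $\{i: v\in B_i\}$ is a non-empty set of consecutive integers. Its width is $\max_i|B_i|-1$. The pathwidth $\mathrm{pw}(G)$ is the minimum width of a path-decomposition of $G$. *)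

theory Defs
  imports "Graph_Theory.Graph_Theory"
begin

(* Finite simple graphs are the loop-free symmetric pair digraphs on a finite vertex set
   (locale pair_graph): an edge vw is represented by the two arcs (v,w) and (w,v). The graph
   without vertices is admitted. *)

definition contained_in :: "'a pair_pre_digraph \<Rightarrow> 'b pair_pre_digraph \<Rightarrow> bool" where
  "contained_in G G' \<longleftrightarrow>
    (\<exists>S. subgraph (with_proj S) (with_proj G') \<and> digraph_iso (with_proj G) (with_proj S))"

definition path_graph :: "nat \<Rightarrow> nat pair_pre_digraph" where
  "path_graph n = \<lparr> pverts = {..<n},
     parcs = {(i, j). i < n \<and> j < n \<and> (j = Suc i \<or> i = Suc j)} \<rparr>"

definition complete_graph :: "nat \<Rightarrow> nat pair_pre_digraph" where
  "complete_graph n = \<lparr> pverts = {..<n}, parcs = {(i, j). i < n \<and> j < n \<and> i \<noteq> j} \<rparr>"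

definition strong_product ::
  "'a pair_pre_digraph \<Rightarrow> 'b pair_pre_digraph \<Rightarrow> ('a \<times> 'b) pair_pre_digraph" where
  "strong_product A B = \<lparr> pverts = pverts A \<times> pverts B,
     parcs = {((v, x), (w, y)).
       (v, x) \<in> pverts A \<times> pverts B \<and> (w, y) \<in> pverts A \<times> pverts B \<and> (v, x) \<noteq> (w, y) \<and>
       (v = w \<and> (x, y) \<in> parcs B \<or> x = y \<and> (v, w) \<in> parcs A \<or>
        (v, w) \<in> parcs A \<and> (x, y) \<in> parcs B)} \<rparr>"

(* At least one bag is required, so that the width is defined also for the graph without
   vertices; for all other graphs this is automatic. *)
definition path_decomposition :: "'a pair_pre_digraph \<Rightarrow> 'a set list \<Rightarrow> bool" where
  "path_decomposition G Bs \<longleftrightarrow>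
     Bs \<noteq> [] \<and>
     (\<forall>B \<in> set Bs. B \<subseteq> pverts G) \<and>
     (\<forall>(v, w) \<in> parcs G. \<exists>B \<in> set Bs. v \<in> B \<and> w \<in> B) \<and>
     (\<forall>v \<in> pverts G. \<exists>a b. a \<le> b \<and> {i. i < length Bs \<and> v \<in> Bs ! i} = {a..b})"

(* Integer-valued: the graph without vertices has a decomposition of width -1. *)
definition pd_width :: "'a set list \<Rightarrow> int" where
  "pd_width Bs = (MAX B \<in> set Bs. int (card B)) - 1"

definition pathwidth :: "'a pair_pre_digraph \<Rightarrow> int" where
  "pathwidth G = Min {pd_width Bs | Bs. path_decomposition G Bs}"

lemma pair_graph_path_graph: "pair_graph (path_graph n)"
proof -
  have "parcs (path_graph n) \<subseteq> {..<n} \<times> {..<n}" by (auto simp: path_graph_def)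
  then have "finite (parcs (path_graph n))" by (rule finite_subset) simp
  then show ?thesis
    by unfold_locales (auto simp: path_graph_def symmetric_def intro!: symI)
qed

lemma complete_graph_is_complete: "complete_digraph n (with_proj (complete_graph n))"
  unfolding complete_digraph_pair_def by (auto simp: complete_graph_def)

lemma pair_graph_strong_product:
  assumes "pair_graph A" "pair_graph B"
  shows "pair_graph (strong_product A B)"
proof -
  interpret A: pair_graph A by fact
  interpret B: pair_graph B by fact
  have sub: "parcs (strong_product A B) \<subseteq> (pverts A \<times> pverts B) \<times> (pverts A \<times> pverts B)"
    by (auto simp: strong_product_def)
  have fin: "finite (pverts A \<times> pverts B)"
    by (intro finite_cartesian_product A.pair_finite_verts B.pair_finite_verts)
  have "finite (parcs (strong_product A B))"
    by (rule finite_subset[OF sub]) (intro finite_cartesian_product fin)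
  then show ?thesis
    using fin
    by unfold_locales
      (auto simp: strong_product_def symmetric_def intro!: symI
        dest: A.arcs_symmetric B.arcs_symmetric)
qed

lemma contained_in_iff:
  assumes "pair_graph G" "pair_graph G'"
  shows "contained_in G G' \<longleftrightarrow>
    (\<exists>f. inj_on f (pverts G) \<and> f ` pverts G \<subseteq> pverts G' \<and>
         (\<forall>v w. (v, w) \<in> parcs G \<longrightarrow> (f v, f w) \<in> parcs G'))"
proof -
  interpret G: pair_graph G by fact
  interpret G': pair_graph G' by fact
  show ?thesis
  proof
    assume "contained_in G G'"
    then obtain S F where S: "subgraph (with_proj S) (with_proj G')"
      and F: "G.digraph_isomorphism F" "with_proj S = app_iso F (with_proj G)"
      unfolding contained_in_def digraph_iso_def by blast
    have "verts (with_proj S) = verts (app_iso F (with_proj G))"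
      "arcs (with_proj S) = arcs (app_iso F (with_proj G))"
      "tail (with_proj S) = tail (app_iso F (with_proj G))"
      "head (with_proj S) = head (app_iso F (with_proj G))"
      using F(2) by simp_all
    then have eqs: "pverts S = iso_verts F ` pverts G" "parcs S = iso_arcs F ` parcs G"
      "iso_tail F = fst" "iso_head F = snd" by simp_all
    have sub: "pverts S \<subseteq> pverts G'" "parcs S \<subseteq> parcs G'"
      using S by (auto simp: subgraph_def)
    have arc: "(iso_verts F v, iso_verts F w) \<in> parcs G'" if "(v, w) \<in> parcs G" for v w
    proof -
      have "iso_arcs F (v, w) = (iso_verts F v, iso_verts F w)"
        using G.iso_verts_tail[OF F(1) that] G.iso_verts_head[OF F(1) that] eqs
        by (simp add: prod_eq_iff)
      then show ?thesis using that eqs(2) sub(2) by (metis image_eqI subsetD)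
    qed
    show "\<exists>f. inj_on f (pverts G) \<and> f ` pverts G \<subseteq> pverts G' \<and>
         (\<forall>v w. (v, w) \<in> parcs G \<longrightarrow> (f v, f w) \<in> parcs G')"
      using G.digraph_isomorphism_inj_on_verts[OF F(1)] eqs(1) sub(1) arc
      by (intro exI[of _ "iso_verts F"]) auto
  next
    assume "\<exists>f. inj_on f (pverts G) \<and> f ` pverts G \<subseteq> pverts G' \<and>
         (\<forall>v w. (v, w) \<in> parcs G \<longrightarrow> (f v, f w) \<in> parcs G')"
    then obtain f where inj: "inj_on f (pverts G)" and vs: "f ` pverts G \<subseteq> pverts G'"
      and es: "\<And>v w. (v, w) \<in> parcs G \<Longrightarrow> (f v, f w) \<in> parcs G'" by blast
    define S where "S = \<lparr> pverts = f ` pverts G, parcs = map_prod f f ` parcs G \<rparr>"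
    define F where "F = \<lparr> iso_verts = f, iso_arcs = map_prod f f, iso_head = snd, iso_tail = fst \<rparr>"
    have "inj_on (map_prod f f) (parcs G)"
      by (rule inj_on_subset[OF map_prod_inj_on[OF inj inj]]) (auto dest: G.wellformed')
    then have iso: "G.digraph_isomorphism F"
      using inj by (auto simp: G.digraph_isomorphism_def F_def G.wf_digraph)
    have eq: "with_proj S = app_iso F (with_proj G)"
      by (simp add: S_def F_def app_iso_def with_proj_def)
    have "wf_digraph (with_proj S)"
      unfolding wf_digraph_wp_iff by unfold_locales (auto simp: S_def dest: G.wellformed')
    then have "subgraph (with_proj S) (with_proj G')"
      using vs es by (auto simp: subgraph_def G'.wf_digraph S_def)
    then show "contained_in G G'"
      unfolding contained_in_def digraph_iso_def using iso eq by blast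
  qed
qed

lemma finite_pd_widths:
  assumes "finite (pverts G)"
  shows "finite {pd_width Bs | Bs. path_decomposition G Bs}"
proof (rule finite_subset)
  show "{pd_width Bs | Bs. path_decomposition G Bs} \<subseteq> (\<lambda>B. int (card B) - 1) ` Pow (pverts G)"
  proof safe
    fix Bs assume pd: "path_decomposition G Bs"
    then have "(MAX B \<in> set Bs. int (card B)) \<in> (\<lambda>B. int (card B)) ` set Bs"
      by (intro Max_in) (auto simp: path_decomposition_def)
    then obtain B where "B \<in> set Bs" "(MAX B \<in> set Bs. int (card B)) = int (card B)" by blast
    with pd show "pd_width Bs \<in> (\<lambda>B. int (card B) - 1) ` Pow (pverts G)"
      by (auto simp: path_decomposition_def pd_width_def)
  qed
qed (use assms in simp)

lemma path_decomposition_single: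
  assumes "pair_graph G"
  shows "path_decomposition G [pverts G]"
proof -
  interpret pair_graph G by fact
  have "\<exists>a b. a \<le> b \<and> {i. i < length [pverts G] \<and> v \<in> [pverts G] ! i} = {a..b}"
    if "v \<in> pverts G" for v
    using that by (intro exI[of _ 0]) auto
  moreover have "\<forall>(v, w) \<in> parcs G. \<exists>B \<in> set [pverts G]. v \<in> B \<and> w \<in> B"
    using wellformed' by auto
  ultimately show ?thesis
    unfolding path_decomposition_def by (intro conjI ballI) simp_all
qed

lemma pathwidth_le_iff:
  assumes "pair_graph G"
  shows "pathwidth G \<le> k \<longleftrightarrow> (\<exists>Bs. path_decomposition G Bs \<and> pd_width Bs \<le> k)"
proof -
  interpret pair_graph G by fact
  show ?thesis
    unfolding pathwidth_def
    using path_decomposition_single[OF assms] finite_pd_widths[OF pair_finite_verts]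
    by (subst Min_le_iff) auto
qed

end

theory Submission
  imports Defs
begin

text \<open>
  In a connected graph without a path on \<open>2h + 3\<close> vertices, any two disjoint paths on
  \<open>2h + 1\<close> vertices have adjacent middle vertices: following half of one path, a shortest connection
  to the other and half of the latter would otherwise give a path that is too long. Three pairwise
  disjoint paths on \<open>2h + 1\<close> vertices are therefore impossible, as half of the first, the
  middle of the second and half of the third would form a path on \<open>2h + 3\<close> vertices. Hence
  at most \<open>4h + 2\<close> vertices meet all paths on \<open>2h + 1\<close> vertices. Contracting them to one vertex
  of \<open>H\<close> that is put into every bag reduces \<open>h + 1\<close> to \<open>h\<close>; for several components
  the path-decompositions are concatenated.
\<close>

section \<open>Paths inside a vertex set\<close>

text \<open>The vertex set is kept apart from the relation, so that deleting vertices changes only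
  \<open>X\<close> and passing to a connected piece leaves \<open>R\<close> untouched.\<close>

definition vertex_path :: "'a rel \<Rightarrow> 'a set \<Rightarrow> 'a list \<Rightarrow> bool" where
  "vertex_path R X xs \<longleftrightarrow> distinct xs \<and> set xs \<subseteq> X \<and> successively (\<lambda>x y. (x, y) \<in> R) xs"

lemma vertex_path_rev:
  assumes "sym R" "vertex_path R X xs"
  shows "vertex_path R X (rev xs)"
  using assms by (auto simp: vertex_path_def elim!: successively_mono dest: symD)

lemma vertex_path_append1:
  "vertex_path R X (xs @ ys) \<Longrightarrow> vertex_path R X xs"
  by (auto simp: vertex_path_def successively_append_iff)

lemma vertex_path_append2:
  "vertex_path R X (xs @ ys) \<Longrightarrow> vertex_path R X ys"
  by (auto simp: vertex_path_def successively_append_iff)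

lemma vertex_path_join:
  assumes "vertex_path R X xs" "vertex_path R X ys" "set xs \<inter> set ys = {}"
    and "xs \<noteq> []" "ys \<noteq> []" "(last xs, hd ys) \<in> R"
  shows "vertex_path R X (xs @ ys)"
  using assms by (auto simp: vertex_path_def successively_append_iff)

lemma vertex_path_shorten:
  assumes "vertex_path R X xs" "n \<le> length xs"
  shows "\<exists>ys. vertex_path R X ys \<and> length ys = n"
proof (intro exI conjI)
  show "vertex_path R X (take n xs)"
    using assms(1) by (metis append_take_drop_id vertex_path_append1)
qed (use assms in simp)

lemma vertex_path_mono:
  "vertex_path R X xs \<Longrightarrow> X \<subseteq> Y \<Longrightarrow> vertex_path R Y xs"
  by (auto simp: vertex_path_def)

text \<open>Apart from \<open>a\<close> there are 2h vertices on \<open>xs\<close>, so one of the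
  two sides of \<open>a\<close> has at least h of them; it is oriented to end in \<open>a\<close>.
  The equality clause is what later identifies the ends of a connection as middle vertices.\<close>

lemma long_half:
  assumes R: "sym R" and xs: "vertex_path R X xs" "length xs = 2 * h + 1" and a: "a \<in> set xs"
  obtains p where "vertex_path R X (p @ [a])" "set (p @ [a]) \<subseteq> set xs" "h \<le> length p"
    "length p = h \<Longrightarrow> a = xs ! h"
proof -
  obtain u v where uv: "xs = u @ a # v"
    using a by (meson split_list)
  have u: "vertex_path R X (u @ [a])"
    using xs(1) vertex_path_append1[of R X "u @ [a]" v] uv by simp
  have "vertex_path R X (a # v)"
    using xs(1) vertex_path_append2[of R X u "a # v"] uv by simp
  from vertex_path_rev[OF R this] have v: "vertex_path R X (rev v @ [a])"
    by simp
  show ?thesis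
  proof (cases "h \<le> length u")
    case True
    show ?thesis
      by (rule that[of u]) (use u True uv in auto)
  next
    case False
    then have "length v > h"
      using xs(2) uv by simp
    \<comment> \<open>The chosen side has more than h vertices, so the equality clause is
      vacuous.\<close>
    then show ?thesis
      using v uv by (intro that[of "rev v"]) auto
  qed
qed

text \<open>Among all walks that start anywhere in \<open>A\<close> and end anywhere in
  \<open>B\<close>, a shortest one can neither meet \<open>A\<close> or \<open>B\<close> in between
  nor repeat an inner vertex, since each of these would allow a shortcut.\<close>

lemma shortest_connection:
  assumes conn: "(x, y) \<in> (R \<inter> X \<times> X)\<^sup>*" and x: "x \<in> A" and y: "y \<in> B"
    and AB: "A \<inter> B = {}"
  obtains a ms b where "a \<in> A" "b \<in> B" "distinct ms" "set ms \<inter> (A \<union> B) = {}"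
    "successively (\<lambda>x y. (x, y) \<in> R \<inter> X \<times> X) (a # ms @ [b])"
proof -
  let ?E = "\<lambda>x y. (x, y) \<in> R \<inter> X \<times> X"
  define P where "P w \<longleftrightarrow> w \<noteq> [] \<and> successively ?E w \<and> hd w \<in> A \<and> last w \<in> B" for w
  have "\<exists>w. w \<noteq> [] \<and> successively ?E w \<and> hd w = x \<and> last w = y"
    using conn
  proof (induction rule: rtrancl_induct)
    case base
    show ?case by (rule exI[of _ "[x]"]) simp
  next
    case (step y z)
    then obtain w where "w \<noteq> [] \<and> successively ?E w \<and> hd w = x \<and> last w = y" by blast
    with step(2) show ?case
      by (intro exI[of _ "w @ [z]"]) (auto simp: successively_append_iff)
  qed
  then have "\<exists>w. P w" using x y by (auto simp: P_def)
  then obtain w where w: "P w" and least: "\<And>v. P v \<Longrightarrow> length w \<le> length v"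
    using ex_has_least_nat[of P _ length] by blast
  obtain a ws where a: "w = a # ws"
    using w by (cases w) (auto simp: P_def)
  have "ws \<noteq> []"
    using w AB a by (auto simp: P_def)
  then obtain ms b where b: "ws = ms @ [b]"
    by (cases ws rule: rev_cases) auto
  have succ: "successively ?E (a # ms @ [b])" and aA: "a \<in> A" and bB: "b \<in> B"
    using w by (auto simp: P_def a b)
  have "m \<notin> A \<union> B" if m: "m \<in> set ms" for m
  proof
    assume "m \<in> A \<union> B"
    obtain p q where pq: "ms = p @ m # q"
      using m by (meson split_list)
    show False
    proof (cases "m \<in> A")
      case True
      \<comment> \<open>The part of the walk from \<open>m\<close> on still leads from
        \<open>A\<close> to \<open>B\<close>; in the other case the part up to \<open>m\<close>
        does.\<close>
      have "successively ?E ((a # p) @ (m # q @ [b]))" using succ pq by simp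
      then have "P (m # q @ [b])"
        unfolding successively_append_iff P_def using True bB by auto
      from least[OF this] show False by (simp add: a b pq)
    next
      case False
      have "successively ?E ((a # p @ [m]) @ (q @ [b]))" using succ pq by simp
      then have "P (a # p @ [m])"
        unfolding successively_append_iff P_def using False \<open>m \<in> A \<union> B\<close> aA by auto
      from least[OF this] show False by (simp add: a b pq)
    qed
  qed
  moreover have "distinct ms"
  proof (rule ccontr)
    assume "\<not> distinct ms"
    \<comment> \<open>Cutting the closed section \<open>q @ [m]\<close> out of the walk makes it
      shorter.\<close>
    then obtain p m q r where pq: "ms = p @ [m] @ q @ [m] @ r"
      using not_distinct_decomp by blast
    have s1: "successively ?E ((a # p @ [m]) @ (q @ m # r @ [b]))"
      and s2: "successively ?E ((a # p @ [m] @ q) @ ([m] @ r @ [b]))"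
      using succ pq by simp_all
    have "successively ?E (a # p @ [m])"
      using s1 unfolding successively_append_iff by blast
    moreover have "successively ?E ([m] @ r @ [b])"
      using s2 unfolding successively_append_iff[of _ "a # p @ [m] @ q"] by blast
    then have "successively ?E (r @ [b])" "?E m (hd (r @ [b]))"
      unfolding successively_append_iff[of _ "[m]"] by auto
    ultimately have "successively ?E ((a # p @ [m]) @ (r @ [b]))"
      unfolding successively_append_iff[of _ "a # p @ [m]"] by simp
    then have "P ((a # p @ [m]) @ (r @ [b]))"
      unfolding P_def using aA bB by simp
    from least[OF this] show False by (simp add: a b pq)
  qed
  ultimately show ?thesis
    using that aA bB succ by blast
qed

section \<open>Disjoint paths in a connected set and a small hitting set\<close>

text \<open>The two long halves and the connection \<open>ms\<close> join to a path on
  \<open>length p + length ms + length q + 2\<close> vertices. This is at least 2h + 2, and at most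
  that by assumption, so there is no slack: \<open>ms\<close> is empty and both halves have exactly
  h vertices besides their ends \<open>a\<close> and \<open>b\<close>, which are therefore the
  middles.\<close>

lemma middles_adjacent:
  assumes R: "sym R" and conn: "X \<times> X \<subseteq> (R \<inter> X \<times> X)\<^sup>*"
    and no: "\<nexists>xs. vertex_path R X xs \<and> length xs = 2 * h + 3"
    and xs: "vertex_path R X xs" "length xs = 2 * h + 1"
    and ys: "vertex_path R X ys" "length ys = 2 * h + 1"
    and disj: "set xs \<inter> set ys = {}"
  shows "(xs ! h, ys ! h) \<in> R"
proof -
  have start: "xs ! 0 \<in> set xs" "ys ! 0 \<in> set ys"
    using xs(2) ys(2) by auto
  then have "xs ! 0 \<in> X" "ys ! 0 \<in> X"
    using xs(1) ys(1) by (auto simp: vertex_path_def)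
  then have conn': "(xs ! 0, ys ! 0) \<in> (R \<inter> X \<times> X)\<^sup>*"
    using conn by blast
  obtain a ms b where a: "a \<in> set xs" and b: "b \<in> set ys" and ms: "distinct ms"
      "set ms \<inter> (set xs \<union> set ys) = {}"
    and succ: "successively (\<lambda>x y. (x, y) \<in> R \<inter> X \<times> X) (a # ms @ [b])"
    by (rule shortest_connection[OF conn' start disj])
  obtain p where p: "vertex_path R X (p @ [a])" "set (p @ [a]) \<subseteq> set xs" "h \<le> length p"
    "length p = h \<Longrightarrow> a = xs ! h"
    using long_half[OF R xs a] by blast
  obtain q where q: "vertex_path R X (q @ [b])" "set (q @ [b]) \<subseteq> set ys" "h \<le> length q"
    "length q = h \<Longrightarrow> b = ys ! h"
    using long_half[OF R ys b] by blast
  have succ': "successively (\<lambda>x y. (x, y) \<in> R) (a # ms @ [b])"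
    by (rule successively_mono[OF succ]) auto
  \<comment> \<open>Every inner vertex has a successor on the walk, and that arc lies in
    \<open>X \<times> X\<close>.\<close>
  have "set ms \<subseteq> X"
  proof
    fix m assume "m \<in> set ms"
    then obtain u v where "ms = u @ m # v" by (meson split_list)
    then have "successively (\<lambda>x y. (x, y) \<in> R \<inter> X \<times> X) ((a # u) @ (m # v @ [b]))"
      using succ by simp
    then show "m \<in> X" unfolding successively_append_iff by auto
  qed
  then have mb: "vertex_path R X (ms @ [b])"
    using succ' ms b ys(1)
    by (auto simp: vertex_path_def successively_append_iff successively_Cons)
  \<comment> \<open>The half of \<open>ys\<close> ends in \<open>b\<close> and is reversed to start
    there. The case of an empty \<open>q\<close> is separate because \<open>vertex_path_join\<close>
    needs non-empty lists.\<close>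
  have mq: "vertex_path R X (ms @ b # rev q)"
  proof (cases "q = []")
    case False
    have "vertex_path R X (b # rev q)"
      using vertex_path_rev[OF R q(1)] by simp
    then have "vertex_path R X (rev q)" "(b, hd (rev q)) \<in> R"
      using False by (auto simp: vertex_path_def successively_Cons)
    moreover have "set (ms @ [b]) \<inter> set (rev q) = {}"
      using ms(2) q(1,2) by (auto simp: vertex_path_def)
    ultimately have "vertex_path R X ((ms @ [b]) @ rev q)"
      using mb False by - (rule vertex_path_join, auto)
    then show ?thesis by simp
  qed (use mb in simp)
  have "(a, hd (ms @ [b])) \<in> R"
    using succ' by (auto simp: successively_Cons)
  then have "(a, hd (ms @ b # rev q)) \<in> R"
    by (cases ms) auto
  moreover have "set (p @ [a]) \<inter> set (ms @ b # rev q) = {}"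
    using disj p(2) q(2) ms(2) by auto
  ultimately have "vertex_path R X ((p @ [a]) @ (ms @ b # rev q))"
    using p(1) mq by - (rule vertex_path_join, auto)
  then have "\<not> 2 * h + 3 \<le> length ((p @ [a]) @ (ms @ b # rev q))"
    using no vertex_path_shorten by blast
  then have "length p = h" "length q = h" "ms = []"
    using p(3) q(3) by (auto simp flip: length_0_conv)
  then show ?thesis
    using p(4) q(4) succ' by simp
qed

lemma no_three_disjoint_paths:
  assumes R: "sym R" and conn: "X \<times> X \<subseteq> (R \<inter> X \<times> X)\<^sup>*"
    and no: "\<nexists>xs. vertex_path R X xs \<and> length xs = 2 * h + 3"
    and xs: "vertex_path R X xs" "length xs = 2 * h + 1"
    and ys: "vertex_path R X ys" "length ys = 2 * h + 1"
    and zs: "vertex_path R X zs" "length zs = 2 * h + 1"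
    and disj: "set xs \<inter> set ys = {}" "set ys \<inter> set zs = {}" "set xs \<inter> set zs = {}"
  shows False
proof -
  have x: "(xs ! h, ys ! h) \<in> R" and z: "(ys ! h, zs ! h) \<in> R"
    using middles_adjacent[OF R conn no] xs ys zs disj by blast+
  have mid: "xs ! h \<in> set xs" "ys ! h \<in> set ys" "zs ! h \<in> set zs"
    using xs(2) ys(2) zs(2) by auto
  \<comment> \<open>Taken at the middles, the two halves have at least h + 1 vertices each; with
    \<open>ys ! h\<close> between them this makes 2h + 3.\<close>
  obtain p where p: "vertex_path R X (p @ [xs ! h])" "set (p @ [xs ! h]) \<subseteq> set xs" "h \<le> length p"
    using long_half[OF R xs mid(1)] by blast
  obtain q where q: "vertex_path R X (q @ [zs ! h])" "set (q @ [zs ! h]) \<subseteq> set zs" "h \<le> length q"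
    using long_half[OF R zs mid(3)] by blast
  have "vertex_path R X [ys ! h]"
    using mid(2) ys(1) by (auto simp: vertex_path_def)
  then have "vertex_path R X ([ys ! h] @ (zs ! h # rev q))"
    using vertex_path_rev[OF R q(1)] q(2) mid disj z by - (rule vertex_path_join, auto)
  then have "vertex_path R X ((p @ [xs ! h]) @ ([ys ! h] @ (zs ! h # rev q)))"
    using p(1,2) q(2) mid disj x by - (rule vertex_path_join, auto)
  moreover have "2 * h + 3 \<le> length ((p @ [xs ! h]) @ ([ys ! h] @ (zs ! h # rev q)))"
    using p(3) q(3) by simp
  ultimately show False
    using no vertex_path_shorten by blast
qed

text \<open>Disjoint paths on 2h + 1 vertices are collected greedily. This stops after at most two
  of them, whence the bound 2(2h + 1). Non-emptiness of \<open>S\<close> provides a representative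
  when \<open>S\<close> is contracted.\<close>

lemma hitting_set:
  assumes R: "sym R" and conn: "X \<times> X \<subseteq> (R \<inter> X \<times> X)\<^sup>*" and X: "X \<noteq> {}"
    and no: "\<nexists>xs. vertex_path R X xs \<and> length xs = 2 * h + 3"
  obtains S where "S \<subseteq> X" "S \<noteq> {}" "card S \<le> 4 * h + 2"
    "\<nexists>xs. vertex_path R (X - S) xs \<and> length xs = 2 * h + 1"
proof (cases "\<exists>xs. vertex_path R X xs \<and> length xs = 2 * h + 1")
  case False
  \<comment> \<open>There is nothing to hit, and an arbitrary vertex serves only to make
    \<open>S\<close> non-empty.\<close>
  obtain x where "x \<in> X" using X by blast
  then show ?thesis
    using False by (intro that[of "{x}"]) (auto dest: vertex_path_mono[of _ "X - {x}" _ X])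
next
  case True
  then obtain xs where xs: "vertex_path R X xs" "length xs = 2 * h + 1" by blast
  have sX: "set xs \<subseteq> X" "set xs \<noteq> {}"
    using xs by (auto simp: vertex_path_def)
  have cx: "card (set xs) \<le> 2 * h + 1"
    using card_length[of xs] xs(2) by simp
  show ?thesis
  proof (cases "\<exists>ys. vertex_path R (X - set xs) ys \<and> length ys = 2 * h + 1")
    case False
    then show ?thesis
      using sX cx by (intro that[of "set xs"]) auto
  next
    case True
    then obtain ys where ys: "vertex_path R (X - set xs) ys" "length ys = 2 * h + 1" by blast
    have ys': "vertex_path R X ys" "set xs \<inter> set ys = {}"
      using ys(1) by (auto simp: vertex_path_def)
    show ?thesis
    proof (rule that[of "set xs \<union> set ys"])
      show "set xs \<union> set ys \<subseteq> X" using sX(1) ys'(1) by (auto simp: vertex_path_def)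
      show "card (set xs \<union> set ys) \<le> 4 * h + 2"
        using card_Un_le[of "set xs" "set ys"] cx card_length[of ys] ys(2) by simp
      show "\<nexists>zs. vertex_path R (X - (set xs \<union> set ys)) zs \<and> length zs = 2 * h + 1"
      proof
        assume "\<exists>zs. vertex_path R (X - (set xs \<union> set ys)) zs \<and> length zs = 2 * h + 1"
        then obtain zs where zs: "vertex_path R (X - (set xs \<union> set ys)) zs"
          "length zs = 2 * h + 1" by blast
        then have "vertex_path R X zs" "set ys \<inter> set zs = {}" "set xs \<inter> set zs = {}"
          by (auto simp: vertex_path_def)
        then show False
          using no_three_disjoint_paths[OF R conn no xs ys'(1) ys(2) _ zs(2) ys'(2)] by blast
      qed
    qed (use sX in auto)
  qed
qed

section \<open>Partitions whose quotient has a path-decomposition\<close>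

text \<open>
  \<open>f\<close> maps every vertex to a representative of its part, and \<open>Bs\<close> is a path-decomposition of
  the quotient graph on the representatives. Taking representatives inside \<open>X\<close> makes the quotients
  of disjoint sets disjoint.
\<close>

definition partition_decomp :: "'a rel \<Rightarrow> 'a set \<Rightarrow> nat \<Rightarrow> nat \<Rightarrow> ('a \<Rightarrow> 'a) \<Rightarrow> 'a set list \<Rightarrow> bool" where
  "partition_decomp R X k N f Bs \<longleftrightarrow>
     f ` X \<subseteq> X \<and> (\<forall>v. card {x \<in> X. f x = v} \<le> N) \<and>
     Bs \<noteq> [] \<and> (\<forall>B \<in> set Bs. B \<subseteq> f ` X \<and> card B \<le> k) \<and>
     (\<forall>x\<in>X. \<forall>y\<in>X. (x, y) \<in> R \<longrightarrow> (\<exists>B \<in> set Bs. f x \<in> B \<and> f y \<in> B)) \<and>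
     (\<forall>v \<in> f ` X. \<exists>a b. a \<le> b \<and> {i. i < length Bs \<and> v \<in> Bs ! i} = {a..b})"

lemma partition_decompD:
  assumes "partition_decomp R X k N f Bs"
  shows "x \<in> X \<Longrightarrow> f x \<in> X" "card {x \<in> X. f x = v} \<le> N" "Bs \<noteq> []"
    "B \<in> set Bs \<Longrightarrow> B \<subseteq> f ` X" "B \<in> set Bs \<Longrightarrow> card B \<le> k"
    "x \<in> X \<Longrightarrow> y \<in> X \<Longrightarrow> (x, y) \<in> R \<Longrightarrow> \<exists>B \<in> set Bs. f x \<in> B \<and> f y \<in> B"
    "x \<in> X \<Longrightarrow> \<exists>a b. a \<le> b \<and> {i. i < length Bs \<and> f x \<in> Bs ! i} = {a..b}"
  using assms by (simp_all add: partition_decomp_def image_subset_iff)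

text \<open>No edge joins \<open>X\<close> and \<open>Y\<close>, and their representatives stay in
  \<open>X\<close> and \<open>Y\<close> respectively. So the parts, bags and intervals of the two
  sides do not interact, and neither \<open>k\<close> nor \<open>N\<close> grows.\<close>

lemma partition_decomp_Un:
  assumes 1: "partition_decomp R X k N f Bs" and 2: "partition_decomp R Y k N g Cs"
    and XY: "X \<inter> Y = {}"
    and sep: "R \<inter> X \<times> Y = {}" "R \<inter> Y \<times> X = {}"
  shows "partition_decomp R (X \<union> Y) k N (\<lambda>x. if x \<in> X then f x else g x) (Bs @ Cs)"
proof -
  define F where "F = (\<lambda>x. if x \<in> X then f x else g x)"
  have fX: "f ` X \<subseteq> X" and gY: "g ` Y \<subseteq> Y"
    using partition_decompD(1)[OF 1] partition_decompD(1)[OF 2] by auto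
  have gX: "g y \<notin> X" if "y \<in> Y" for y
    using that gY XY by blast
  have FX: "F ` X = f ` X" and FY: "F ` Y = g ` Y"
    using XY by (auto simp: F_def intro!: image_cong)
  have Bs: "B \<subseteq> f ` X" "card B \<le> k" if "B \<in> set Bs" for B
    using partition_decompD(4,5)[OF 1 that] by auto
  have Cs: "B \<subseteq> g ` Y" "card B \<le> k" if "B \<in> set Cs" for B
    using partition_decompD(4,5)[OF 2 that] by auto
  have fib: "card {x \<in> X \<union> Y. F x = v} \<le> N" for v
  proof (cases "v \<in> X")
    case True
    then have "{x \<in> X \<union> Y. F x = v} = {x \<in> X. f x = v}"
      by (auto simp: F_def dest: gX)
    then show ?thesis using partition_decompD(2)[OF 1] by simp
  next
    case False
    then have "{x \<in> X \<union> Y. F x = v} = {x \<in> Y. g x = v}"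
      using XY fX by (auto simp: F_def)
    then show ?thesis using partition_decompD(2)[OF 2] by simp
  qed
  have cov: "\<exists>B \<in> set (Bs @ Cs). F x \<in> B \<and> F y \<in> B"
    if xy: "x \<in> X \<union> Y" "y \<in> X \<union> Y" "(x, y) \<in> R" for x y
  proof (cases "x \<in> X")
    case True
    then have "y \<in> X" using xy sep by auto
    with True partition_decompD(6)[OF 1 _ _ xy(3)] show ?thesis by (auto simp: F_def)
  next
    case False
    then have "x \<in> Y" "y \<in> Y" "y \<notin> X" using xy sep XY by auto
    with False partition_decompD(6)[OF 2 _ _ xy(3)] show ?thesis by (auto simp: F_def)
  qed
  have int: "\<exists>a b. a \<le> b \<and> {i. i < length (Bs @ Cs) \<and> v \<in> (Bs @ Cs) ! i} = {a..b}"
    if "v \<in> F ` (X \<union> Y)" for v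
  proof (cases "v \<in> f ` X")
    case True
    \<comment> \<open>Bags of \<open>Cs\<close> consist of representatives in \<open>Y\<close>,
      whereas \<open>v\<close> lies in \<open>X\<close>.\<close>
    have notC: "v \<notin> Cs ! i" if "i < length Cs" for i
      using Cs(1)[OF nth_mem[OF that]] True XY fX gY by blast
    have "i < length (Bs @ Cs) \<and> v \<in> (Bs @ Cs) ! i \<longleftrightarrow> i < length Bs \<and> v \<in> Bs ! i" for i
      using notC[of "i - length Bs"] by (auto simp: nth_append)
    then show ?thesis using partition_decompD(7)[OF 1] True by auto
  next
    case False
    then have v: "v \<in> g ` Y" using that FX FY by (auto simp: image_Un)
    have notB: "v \<notin> Bs ! i" if "i < length Bs" for i
      using Bs(1)[OF nth_mem[OF that]] False by blast
    obtain a b where ab: "a \<le> b" "{i. i < length Cs \<and> v \<in> Cs ! i} = {a..b}"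
      using partition_decompD(7)[OF 2] v by blast
    \<comment> \<open>The bags of \<open>Cs\<close> come after those of \<open>Bs\<close>, so the
      interval of \<open>v\<close> is shifted by \<open>length Bs\<close>.\<close>
    have "{i. i < length (Bs @ Cs) \<and> v \<in> (Bs @ Cs) ! i}
        = (\<lambda>i. i + length Bs) ` {i. i < length Cs \<and> v \<in> Cs ! i}"
    proof (intro equalityI subsetI)
      fix i assume "i \<in> {i. i < length (Bs @ Cs) \<and> v \<in> (Bs @ Cs) ! i}"
      then show "i \<in> (\<lambda>i. i + length Bs) ` {i. i < length Cs \<and> v \<in> Cs ! i}"
        using notB by (intro image_eqI[of _ _ "i - length Bs"])
          (auto simp: nth_append split: if_splits)
    qed (auto simp: nth_append)
    also have "\<dots> = {a + length Bs..b + length Bs}"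
      unfolding ab(2) by simp
    finally show ?thesis
      using add_right_mono[OF ab(1), of "length Bs"] by blast
  qed
  show ?thesis
    unfolding partition_decomp_def F_def[symmetric]
  proof (intro conjI allI ballI impI)
    show "F ` (X \<union> Y) \<subseteq> X \<union> Y" using FX FY fX gY by (auto simp: image_Un)
    show "Bs @ Cs \<noteq> []" using partition_decompD(3)[OF 1] by simp
    show "B \<subseteq> F ` (X \<union> Y)" if "B \<in> set (Bs @ Cs)" for B
      using that Bs(1) Cs(1) FX FY by (auto simp: image_Un)
    show "card B \<le> k" if "B \<in> set (Bs @ Cs)" for B
      using that Bs(2) Cs(2) by auto
  qed (fact fib cov int)+
qed

text \<open>As \<open>f\<close> maps \<open>X - S\<close> into itself, \<open>s\<close> is not yet a
  representative and \<open>S\<close> becomes a part of its own. Putting \<open>s\<close> into every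
  bag covers all edges at \<open>S\<close> at the cost of one vertex per bag, while the other parts
  are unchanged.\<close>

lemma partition_decomp_apex:
  assumes dec: "partition_decomp R (X - S) k N f Bs"
    and S: "S \<subseteq> X" "s \<in> S" "card S \<le> M" and NM: "N \<le> M"
  shows "partition_decomp R X (Suc k) M (\<lambda>x. if x \<in> S then s else f x) (map (insert s) Bs)"
proof -
  define F where "F = (\<lambda>x. if x \<in> S then s else f x)"
  have fX: "f ` (X - S) \<subseteq> X - S"
    using partition_decompD(1)[OF dec] by auto
  have FS: "F x = s" if "x \<in> S" for x using that by (simp add: F_def)
  have FX: "F ` X = insert s (f ` (X - S))"
    using S by (auto simp: F_def)
  have Bs: "B \<subseteq> f ` (X - S)" "card B \<le> k" if "B \<in> set Bs" for B
    using partition_decompD(4,5)[OF dec that] by auto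
  have ne: "Bs \<noteq> []" using partition_decompD(3)[OF dec] .
  have fib: "card {x \<in> X. F x = v} \<le> M" for v
  proof (cases "v = s")
    case True
    then have "{x \<in> X. F x = v} = S"
      using S fX by (auto simp: F_def)
    then show ?thesis using S by simp
  next
    case False
    then have "{x \<in> X. F x = v} = {x \<in> X - S. f x = v}"
      by (auto simp: F_def)
    then show ?thesis using partition_decompD(2)[OF dec, of v] NM by simp
  qed
  \<comment> \<open>The interval of \<open>f x\<close> is non-empty; any bag in it will also contain
    \<open>s\<close>, which covers the edges between \<open>S\<close> and \<open>x\<close>.\<close>
  have bag: "\<exists>B \<in> set Bs. f x \<in> B" if x: "x \<in> X - S" for x
  proof -
    obtain a b where "a \<le> b" "{i. i < length Bs \<and> f x \<in> Bs ! i} = {a..b}"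
      using partition_decompD(7)[OF dec x] by blast
    then have "a \<in> {i. i < length Bs \<and> f x \<in> Bs ! i}" by simp
    then show ?thesis by auto
  qed
  have cov: "\<exists>B \<in> set (map (insert s) Bs). F x \<in> B \<and> F y \<in> B"
    if xy: "x \<in> X" "y \<in> X" "(x, y) \<in> R" for x y
  proof -
    consider "x \<in> S" "y \<in> S" | "x \<in> S" "y \<notin> S" | "x \<notin> S" "y \<in> S" | "x \<notin> S" "y \<notin> S" by blast
    then show ?thesis
    proof cases
      case 1
      then show ?thesis using ne by (auto simp: F_def neq_Nil_conv)
    next
      case 2
      then show ?thesis using bag[of y] xy by (auto simp: F_def)
    next
      case 3
      then show ?thesis using bag[of x] xy by (auto simp: F_def)
    next
      case 4
      then have "\<exists>B \<in> set Bs. f x \<in> B \<and> f y \<in> B"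
        using partition_decompD(6)[OF dec] xy by blast
      then show ?thesis using 4 by (auto simp: F_def)
    qed
  qed
  have int: "\<exists>a b. a \<le> b \<and>
      {i. i < length (map (insert s) Bs) \<and> v \<in> map (insert s) Bs ! i} = {a..b}"
    if "v \<in> F ` X" for v
  proof (cases "v = s")
    case True
    then have "{i. i < length (map (insert s) Bs) \<and> v \<in> map (insert s) Bs ! i}
      = {..<length Bs}"
      by auto
    also have "\<dots> = {0..length Bs - 1}"
      using ne by (cases Bs) auto
    finally show ?thesis by (intro exI conjI) auto
  next
    case False
    then have "{i. i < length (map (insert s) Bs) \<and> v \<in> map (insert s) Bs ! i}
      = {i. i < length Bs \<and> v \<in> Bs ! i}"
      by auto
    moreover have "v \<in> f ` (X - S)" using that False FX by simp
    ultimately show ?thesis using partition_decompD(7)[OF dec] by auto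
  qed
  show ?thesis
    unfolding partition_decomp_def F_def[symmetric]
  proof (intro conjI allI ballI impI)
    show "F ` X \<subseteq> X" using FX fX S by auto
    show "map (insert s) Bs \<noteq> []" using ne by simp
    show "B \<subseteq> F ` X" if "B \<in> set (map (insert s) Bs)" for B
      using that Bs(1) FX by auto
    show "card B \<le> Suc k" if B: "B \<in> set (map (insert s) Bs)" for B
    proof -
      obtain C where "C \<in> set Bs" "B = insert s C" using B by auto
      then show ?thesis
        using Bs(2)[of C] card_insert_le_m1[of "Suc k" C s] by simp
    qed
  qed (fact fib cov int)+
qed

section \<open>Induction on h and on the vertex set\<close>

text \<open>The outer induction lowers h by contracting a hitting set. What remains need not be
  connected, so \<open>X\<close> is arbitrary there, and an inner induction on \<open>X\<close> with
  h fixed splits disconnected sets.\<close>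

lemma partition_decomp_exists:
  assumes "finite X" "sym R" "\<nexists>xs. vertex_path R X xs \<and> length xs = 2 * h + 1"
  shows "\<exists>f Bs. partition_decomp R X h (4 * h) f Bs"
  using assms(1,3)
proof (induction h arbitrary: X)
  case 0
  \<comment> \<open>For h = 0 already a single vertex is a forbidden path. One empty bag is then
    used, since the list of bags must be non-empty.\<close>
  have "X = {}"
  proof (rule ccontr)
    assume "X \<noteq> {}"
    then obtain x where "x \<in> X" by blast
    then have "vertex_path R X [x]" by (simp add: vertex_path_def)
    with 0(2) show False by fastforce
  qed
  then show ?case
    by (intro exI[of _ id] exI[of _ "[{}]"]) (simp add: partition_decomp_def)
next
  case (Suc h)
  note IH = Suc.IH
  from Suc.prems show ?case
  proof (induction X rule: finite_psubset_induct)
    case (psubset X)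
    show ?case
    proof (cases "X = {}")
      case True
      then show ?thesis
        by (intro exI[of _ id] exI[of _ "[{}]"]) (simp add: partition_decomp_def)
    next
      case X: False
      let ?R = "R \<inter> X \<times> X"
      have no: "\<nexists>xs. vertex_path R X xs \<and> length xs = 2 * h + 3"
        using psubset.prems by (simp add: numeral_3_eq_3)
      show ?thesis
      proof (cases "X \<times> X \<subseteq> ?R\<^sup>*")
        case True
        obtain S where S: "S \<subseteq> X" "S \<noteq> {}" "card S \<le> 4 * h + 2"
          "\<nexists>xs. vertex_path R (X - S) xs \<and> length xs = 2 * h + 1"
          using hitting_set[OF assms(2) True X no] by blast
        obtain s where s: "s \<in> S" using S(2) by blast
        obtain f Bs where "partition_decomp R (X - S) h (4 * h) f Bs"
          using IH[of "X - S"] S(4) psubset.hyps by auto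
        \<comment> \<open>Both 4h + 2, the bound for the new part, and 4h, the bound for the old
          ones, are at most 4(h + 1).\<close>
        from partition_decomp_apex[OF this S(1) s, of "4 * Suc h"] S(3) show ?thesis
          by auto
      next
        case False
        then obtain x y where xy: "x \<in> X" "y \<in> X" "(x, y) \<notin> ?R\<^sup>*" by blast
        \<comment> \<open>This is the component of \<open>x\<close>. It contains \<open>x\<close>
          but not \<open>y\<close>, so \<open>C\<close> and \<open>X - C\<close> are both proper
          subsets of \<open>X\<close>.\<close>
        define C where "C = {z \<in> X. (x, z) \<in> ?R\<^sup>*}"
        have C: "C \<subset> X" "X - C \<subset> X"
          using xy by (auto simp: C_def)
        have sep: "R \<inter> C \<times> (X - C) = {}"
          by (auto simp: C_def intro: rtrancl_into_rtrancl)
        then have sep': "R \<inter> (X - C) \<times> C = {}"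
          using assms(2) by (auto simp: sym_def)
        have "\<exists>f Bs. partition_decomp R Y (Suc h) (4 * Suc h) f Bs" if "Y \<subset> X" for Y
          using psubset.IH[OF that] psubset.prems vertex_path_mono[of R Y _ X] that by blast
        then obtain f Bs g Cs where "partition_decomp R C (Suc h) (4 * Suc h) f Bs"
          "partition_decomp R (X - C) (Suc h) (4 * Suc h) g Cs"
          using C by metis
        from partition_decomp_Un[OF this _ sep sep'] C(1) show ?thesis
          by (auto simp: Un_absorb1)
      qed
    qed
  qed
qed

section \<open>From the partition to the strong product\<close>

lemma contained_in_path_graph:
  assumes "pair_graph G" "vertex_path (parcs G) (pverts G) xs"
  shows "contained_in (path_graph (length xs)) G"
  unfolding contained_in_iff[OF pair_graph_path_graph assms(1)]
proof (intro exI[of _ "\<lambda>i. xs ! i"] conjI allI impI)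
  interpret pair_graph G by fact
  show "inj_on (\<lambda>i. xs ! i) (pverts (path_graph (length xs)))"
    using assms(2) by (auto simp: vertex_path_def path_graph_def intro!: inj_on_nth)
  show "(\<lambda>i. xs ! i) ` pverts (path_graph (length xs)) \<subseteq> pverts G"
    using assms(2) by (auto simp: vertex_path_def path_graph_def)
  fix i j assume "(i, j) \<in> parcs (path_graph (length xs))"
  then show "(xs ! i, xs ! j) \<in> parcs G"
    using assms(2) arcs_symmetric
    by (auto simp: vertex_path_def path_graph_def successively_conv_nth)
qed

theorem proposition4:
  fixes h :: nat and G :: "'a pair_pre_digraph"
  assumes "h \<ge> 1"
    and "pair_graph G"
    and "\<not> contained_in (path_graph (2 * h + 1)) G"
  shows "\<exists>H :: nat pair_pre_digraph.
           pair_graph H \<and> pathwidth H \<le> int h - 1 \<and>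
           contained_in G (strong_product H (complete_graph (4 * h)))"
proof -
  interpret G: pair_graph G by fact
  let ?V = "pverts G" and ?R = "parcs G"
  have "sym ?R" using G.arcs_symmetric by (auto simp: sym_def)
  moreover have "\<nexists>xs. vertex_path ?R ?V xs \<and> length xs = 2 * h + 1"
    using contained_in_path_graph[OF assms(2)] assms(3) by metis
  ultimately obtain f Bs where fB: "partition_decomp ?R ?V h (4 * h) f Bs"
    using partition_decomp_exists[OF G.pair_finite_verts] by blast
  have fV: "f ` ?V \<subseteq> ?V"
    using partition_decompD(1)[OF fB] by auto
  note fib = partition_decompD(2)[OF fB] and ne = partition_decompD(3)[OF fB]
    and Bs = partition_decompD(4,5)[OF fB] and int = partition_decompD(7)[OF fB]
  have cov: "\<exists>B \<in> set Bs. f x \<in> B \<and> f y \<in> B" if "(x, y) \<in> ?R" for x y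
    using partition_decompD(6)[OF fB _ _ that] G.wellformed'[OF that] by blast
  \<comment> \<open>The vertices of \<open>H\<close> have to be natural numbers, so representatives
    are encoded by an injection \<open>e\<close>.\<close>
  obtain e :: "'a \<Rightarrow> nat" where e: "inj_on e ?V"
    using finite_imp_inj_to_nat_seg[OF G.pair_finite_verts] by blast
  \<comment> \<open>The quotient graph of the partition; the condition
    \<open>f x \<noteq> f y\<close> discards the loops that edges inside a part would
    produce.\<close>
  define H where "H = \<lparr> pverts = (\<lambda>x. e (f x)) ` ?V,
    parcs = {(e (f x), e (f y)) | x y. (x, y) \<in> ?R \<and> f x \<noteq> f y} \<rparr>"
  have e_eq: "e (f x) = e (f y) \<longleftrightarrow> f x = f y" if "x \<in> ?V" "y \<in> ?V" for x y
    using that fV e by (auto simp: inj_on_def)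
  have "parcs H \<subseteq> pverts H \<times> pverts H"
    using G.wellformed' by (auto simp: H_def)
  moreover have finH: "finite (pverts H)" by (simp add: H_def)
  ultimately have "finite (parcs H)" by (meson finite_SigmaI finite_subset)
  then have H: "pair_graph H"
    using finH G.wellformed' G.arcs_symmetric e_eq
    by unfold_locales (fastforce simp: H_def symmetric_def intro!: symI)+
  have "path_decomposition H (map (image e) Bs)"
    unfolding path_decomposition_def
  proof (intro conjI ballI)
    show "map (image e) Bs \<noteq> []" using ne by simp
    show "B \<subseteq> pverts H" if "B \<in> set (map (image e) Bs)" for B
      using that Bs(1) by (fastforce simp: H_def)
    show "case p of (v, w) \<Rightarrow> \<exists>B \<in> set (map (image e) Bs). v \<in> B \<and> w \<in> B" if "p \<in> parcs H" for p
      using that cov by (fastforce simp: H_def)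
    fix v assume "v \<in> pverts H"
    then obtain u where u: "u \<in> f ` ?V" "v = e u" by (auto simp: H_def)
    \<comment> \<open>Injectivity of \<open>e\<close> on the vertices keeps the set of bag indices,
      and hence the interval, unchanged.\<close>
    have "e u \<in> e ` (Bs ! i) \<longleftrightarrow> u \<in> Bs ! i" if "i < length Bs" for i
      using Bs(1)[OF nth_mem[OF that]] u(1) fV by (intro inj_on_image_mem_iff[OF e]) auto
    then have "{i. i < length (map (image e) Bs) \<and> v \<in> map (image e) Bs ! i}
      = {i. i < length Bs \<and> u \<in> Bs ! i}"
      using u(2) by auto
    then show "\<exists>a b. a \<le> b \<and>
        {i. i < length (map (image e) Bs) \<and> v \<in> map (image e) Bs ! i} = {a..b}"
      using int u(1) by auto
  qed
  moreover have "pd_width (map (image e) Bs) \<le> int h - 1"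
  proof -
    have "card (e ` B) \<le> h" if "B \<in> set Bs" for B
    proof -
      have "finite B" using Bs(1)[OF that] by (meson G.pair_finite_verts finite_imageI finite_subset)
      then show ?thesis using card_image_le[of B e] Bs(2)[OF that] by linarith
    qed
    then have "(MAX B \<in> set (map (image e) Bs). int (card B)) \<le> int h"
      using ne by (subst Max_le_iff) auto
    then show ?thesis by (simp add: pd_width_def)
  qed
  ultimately have pw: "pathwidth H \<le> int h - 1"
    using pathwidth_le_iff[OF H] by blast
  \<comment> \<open>Each part has at most 4h vertices, so \<open>g v\<close> can number the part of
    \<open>v\<close> by distinct vertices of the complete graph. The embedding \<open>?F\<close>
    pairs the part with this number.\<close>
  have "\<exists>g. inj_on g {x \<in> ?V. f x = v} \<and> g ` {x \<in> ?V. f x = v} \<subseteq> {..<4 * h}" for v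
    using card_le_inj[of "{x \<in> ?V. f x = v}" "{..<4 * h}"] fib[of v] by auto
  then obtain g where g: "\<And>v. inj_on (g v) {x \<in> ?V. f x = v}"
    "\<And>v. g v ` {x \<in> ?V. f x = v} \<subseteq> {..<4 * h}"
    by metis
  let ?K = "complete_graph (4 * h)" and ?F = "\<lambda>x. (e (f x), g (f x) x)"
  have K: "pair_graph ?K"
  proof -
    have "parcs ?K \<subseteq> {..<4 * h} \<times> {..<4 * h}" by (auto simp: complete_graph_def)
    then have "finite (parcs ?K)" by (rule finite_subset) simp
    then show ?thesis
      by unfold_locales (auto simp: complete_graph_def symmetric_def intro!: symI)
  qed
  have gK: "g (f x) x \<in> pverts ?K" if "x \<in> ?V" for x
    using g(2)[of "f x"] that by (auto simp: complete_graph_def)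
  have inj: "inj_on ?F ?V"
  proof (rule inj_onI)
    fix x y assume xy: "x \<in> ?V" "y \<in> ?V" "?F x = ?F y"
    then have "f x = f y" using e_eq by simp
    with xy show "x = y" using g(1)[of "f x"] by (auto simp: inj_on_def)
  qed
  have im: "?F x \<in> pverts H \<times> pverts ?K" if "x \<in> ?V" for x
    using that gK by (auto simp: H_def)
  have arc: "(?F x, ?F y) \<in> parcs (strong_product H ?K)" if xy: "(x, y) \<in> ?R" for x y
  proof -
    have V: "x \<in> ?V" "y \<in> ?V" "x \<noteq> y"
      using xy G.wellformed' G.no_loops' by auto
    then have ne': "?F x \<noteq> ?F y" using inj by (meson inj_onD)
    have "e (f x) = e (f y) \<and> (g (f x) x, g (f y) y) \<in> parcs ?K \<or>
      g (f x) x = g (f y) y \<and> (e (f x), e (f y)) \<in> parcs H \<or>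
      (e (f x), e (f y)) \<in> parcs H \<and> (g (f x) x, g (f y) y) \<in> parcs ?K"
    \<comment> \<open>Adjacent vertices of one part have distinct, hence adjacent, numbers. Those of
      different parts are adjacent in \<open>H\<close>, and their numbers are equal or
      adjacent.\<close>
    proof (cases "f x = f y")
      case True
      then show ?thesis using ne' gK[OF V(1)] gK[OF V(2)] by (auto simp: complete_graph_def)
    next
      case False
      then have "(e (f x), e (f y)) \<in> parcs H" using xy by (auto simp: H_def)
      then show ?thesis using gK[OF V(1)] gK[OF V(2)] by (auto simp: complete_graph_def)
    qed
    then show ?thesis
      using ne' im[OF V(1)] im[OF V(2)] unfolding strong_product_def by simp
  qed
  have "contained_in G (strong_product H ?K)"
    unfolding contained_in_iff[OF assms(2) pair_graph_strong_product[OF H K]]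
    using inj im arc by (intro exI[of _ ?F]) (auto simp: strong_product_def)
  with H pw show ?thesis by blast
qed

end
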